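(* Let $N\in\mathbb{N}$, let $u(t),y(t)\in\mathbb{R}$ for $t\le N$ be the input and output data, and let $\gamma_b=\frac{\sigma^2}{N\lambda_b}$, $\gamma_c=\frac{\sigma^2}{N\lambda_c}$ with $\sigma^2,\lambda_b,\lambda_c>0$. Let $\mathcal{H}_b,\mathcal{H}_c\subseteq\ell^2$ be the reproducing kernel Hilbert spaces (of real sequences indexed by $k=1,2,\dots$) with kernels $\mathcal{K}_b,\mathcal{K}_c\in\mathbb{R}^{\infty\times\infty}$ and norms $\|\cdot\|_{\mathcal{H}_b},\|\cdot\|_{\mathcal{H}_c}$. Assume that (1) $\mathcal{K}_b$ and $\mathcal{K}_c$ are stable, i.e. $\mathcal{H}_b\subset\ell^1$ and $\mathcal{H}_c\subset\ell^1$; (2) $M\in\mathbb{N}$ is such that $y(s)=u(s)=0$ for all $s<-M$. Then every solution $(b,c)$ of the problem $$\min_{\vartheta=(b,c)\in\mathcal{H}_b\times\mathcal{H}_c} V_N(\vartheta)+\gamma_b\|b\|_{\mathcal{H}_b}^2+\gamma_c\|c\|_{\mathcal{H}_c}^2$$ admits a representation $$b=\sum_{k=1}^{N+M}\alpha_k[\mathcal{K}_b]_k,\qquad c=\sum_{k=1}^{N+M}\beta_k[\mathcal{K}_c]_k,$$ where $[\mathcal{K}_b]_k$ and $[\mathcal{K}_c]_k$ denote the $k$-th columns of $\mathcal{K}_b$ and $\mathcal{K}_c$, respectively, and $\alpha_k,\beta_k$, $k=1,\dots,N+M$, are real numbers.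
   Context: $\ell^1$ and $\ell^2$ are the spaces of absolutely summable and square summable real sequences indexed by $k=1,2,\dots$. For $\vartheta=(b,c)$ with $b=(b_k)_{k\ge1}$, $c=(c_k)_{k\ge1}$, put $B(z)=\sum_{k=1}^\infty b_kz^{-k}$ and $C(z)=1+\sum_{k=1}^\infty c_kz^{-k}$, where $z^{-1}$ acts as the backward shift on signals. The prediction error is $$\varepsilon_\vartheta(t)=\frac{1}{C(z)}\,[\,y(t)-B(z)u(t)\,],$$ and the average squared prediction error is $V_N(\vartheta)=\frac1N\sum_{t=1}^N\varepsilon_\vartheta(t)^2$. Explicitly, $1/C(z)=\sum_{k\ge0}h_kz^{-k}$ is the formal power series inverse of $C(z)$ in $z^{-1}$, with $h_0=1$ and $h_k=-c_k-\sum_{i=1}^{k-1}c_ih_{k-i}$ for $k\ge1$. When $y(s)=u(s)=0$ for all $s<-M$, $$\varepsilon_\vartheta(t)=\sum_{k=0}^{t+M}h_k\,y(t-k)-\sum_{k=0}^{t+M}\sum_{l=1}^{t-k+M}h_kb_l\,u(t-k-l),\qquad t=1,\dots,N,$$ which is a finite sum. *)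

theory Defs
  imports "HOL-Analysis.Analysis" "HOL-Computational_Algebra.Formal_Power_Series"
begin

text \<open>
  A real function on a set \<open>X\<close> is represented by a function on the ambient type that is \<open>0\<close> outside
  \<open>X\<close>.  In particular a sequence indexed by \<open>1, 2, \<dots>\<close> is an \<open>x :: nat \<Rightarrow> real\<close> with \<open>x 0 = 0\<close>.
\<close>

definition ell1 :: "(nat \<Rightarrow> real) set" where
  "ell1 = {x. x 0 = 0 \<and> (\<lambda>k. \<bar>x k\<bar>) summable_on {1..}}"

definition ell2 :: "(nat \<Rightarrow> real) set" where
  "ell2 = {x. x 0 = 0 \<and> (\<lambda>k. (x k)\<^sup>2) summable_on {1..}}"

definition ip_norm :: "('f \<Rightarrow> 'f \<Rightarrow> real) \<Rightarrow> 'f \<Rightarrow> real" where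
  "ip_norm ip f = sqrt (ip f f)"

text \<open>The inner product is constrained only on \<open>H\<close>.\<close>

locale function_hilbert_space =
  fixes X :: "'a set"
    and H :: "('a \<Rightarrow> real) set"
    and ip :: "('a \<Rightarrow> real) \<Rightarrow> ('a \<Rightarrow> real) \<Rightarrow> real"
  assumes supp: "\<And>f x. f \<in> H \<Longrightarrow> x \<notin> X \<Longrightarrow> f x = 0"
    and zero_mem: "(\<lambda>x. 0) \<in> H"
    and add_mem: "\<And>f g. f \<in> H \<Longrightarrow> g \<in> H \<Longrightarrow> (\<lambda>x. f x + g x) \<in> H"
    and scale_mem: "\<And>a f. f \<in> H \<Longrightarrow> (\<lambda>x. a * f x) \<in> H"
    and ip_add: "\<And>f g h. f \<in> H \<Longrightarrow> g \<in> H \<Longrightarrow> h \<in> H \<Longrightarrow> ip (\<lambda>x. f x + g x) h = ip f h + ip g h"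
    and ip_scale: "\<And>a f h. f \<in> H \<Longrightarrow> h \<in> H \<Longrightarrow> ip (\<lambda>x. a * f x) h = a * ip f h"
    and ip_commute: "\<And>f g. f \<in> H \<Longrightarrow> g \<in> H \<Longrightarrow> ip f g = ip g f"
    and ip_nonneg: "\<And>f. f \<in> H \<Longrightarrow> 0 \<le> ip f f"
    and ip_eq_0: "\<And>f. f \<in> H \<Longrightarrow> ip f f = 0 \<Longrightarrow> f = (\<lambda>x. 0)"
    and complete: "\<And>F :: nat \<Rightarrow> 'a \<Rightarrow> real.
      (\<And>n. F n \<in> H) \<Longrightarrow>
      (\<forall>e>0. \<exists>n0. \<forall>m\<ge>n0. \<forall>n\<ge>n0. ip_norm ip (\<lambda>x. F m x - F n x) < e) \<Longrightarrow>
      \<exists>f\<in>H. (\<lambda>n. ip_norm ip (\<lambda>x. F n x - f x)) \<longlonglongrightarrow> 0"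

definition kernel_column :: "'a set \<Rightarrow> ('a \<Rightarrow> 'a \<Rightarrow> real) \<Rightarrow> 'a \<Rightarrow> 'a \<Rightarrow> real" where
  "kernel_column X K k = (\<lambda>i. if i \<in> X then K i k else 0)"

locale rkhs = function_hilbert_space X H ip
  for X :: "'a set" and H and ip +
  fixes K :: "'a \<Rightarrow> 'a \<Rightarrow> real"
  assumes column_mem: "\<And>k. k \<in> X \<Longrightarrow> kernel_column X K k \<in> H"
    and reproducing: "\<And>f k. f \<in> H \<Longrightarrow> k \<in> X \<Longrightarrow> ip f (kernel_column X K k) = f k"

text \<open>Formal power series are taken in the backward shift \<open>z\<inverse>\<close>.\<close>

definition B_series :: "(nat \<Rightarrow> real) \<Rightarrow> real fps" where
  "B_series b = Abs_fps (\<lambda>k. if k = 0 then 0 else b k)"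

definition C_series :: "(nat \<Rightarrow> real) \<Rightarrow> real fps" where
  "C_series c = 1 + Abs_fps (\<lambda>k. if k = 0 then 0 else c k)"

text \<open>
  For signals vanishing in the remote past the series below has finitely many nonzero terms.
\<close>

definition shift_filter :: "real fps \<Rightarrow> (int \<Rightarrow> real) \<Rightarrow> int \<Rightarrow> real" where
  "shift_filter F w t = (\<Sum>k. fps_nth F k * w (t - int k))"

definition prediction_error ::
  "(int \<Rightarrow> real) \<Rightarrow> (int \<Rightarrow> real) \<Rightarrow> (nat \<Rightarrow> real) \<times> (nat \<Rightarrow> real) \<Rightarrow> int \<Rightarrow> real" where
  "prediction_error u y = (\<lambda>(b, c).
     shift_filter (inverse (C_series c)) (\<lambda>t. y t - shift_filter (B_series b) u t))"

definition avg_sq_error ::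
  "nat \<Rightarrow> (int \<Rightarrow> real) \<Rightarrow> (int \<Rightarrow> real) \<Rightarrow> (nat \<Rightarrow> real) \<times> (nat \<Rightarrow> real) \<Rightarrow> real" where
  "avg_sq_error N u y \<theta> = (1 / real N) * (\<Sum>t = 1..N. (prediction_error u y \<theta> (int t))\<^sup>2)"

lemma inverse_C_series_0: "fps_nth (inverse (C_series c)) 0 = 1"
  by (simp add: C_series_def)

lemma inverse_C_series_rec:
  assumes "k \<ge> 1"
  shows "fps_nth (inverse (C_series c)) k =
    - c k - (\<Sum>i = 1..k - 1. c i * fps_nth (inverse (C_series c)) (k - i))"
proof -
  let ?h = "fps_nth (inverse (C_series c))"
  have "C_series c * inverse (C_series c) = 1"
    by (rule inverse_mult_eq_1') (simp add: C_series_def)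
  then have "0 = fps_nth (C_series c * inverse (C_series c)) k"
    using assms by simp
  also have "\<dots> = (\<Sum>i = 0..k. fps_nth (C_series c) i * ?h (k - i))"
    by (simp add: fps_mult_nth)
  also have "\<dots> = ?h k + (\<Sum>i = 1..k. fps_nth (C_series c) i * ?h (k - i))"
    by (simp add: sum.atLeast_Suc_atMost C_series_def)
  also have "(\<Sum>i = 1..k. fps_nth (C_series c) i * ?h (k - i)) = (\<Sum>i = 1..k. c i * ?h (k - i))"
    by (rule sum.cong) (auto simp: C_series_def)
  also have "{1..k} = insert k {1..k - 1}"
    using assms by auto
  finally show ?thesis
    using assms by (simp add: C_series_def)
qed

lemma shift_filter_finite:
  assumes "\<And>s. s < - int M \<Longrightarrow> w s = 0"
  shows "shift_filter F w t =
    (if t < - int M then 0 else \<Sum>k = 0..nat (t + int M). fps_nth F k * w (t - int k))"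
proof (cases "t < - int M")
  case True
  then show ?thesis
    using assms by (simp add: shift_filter_def)
next
  case False
  have "(\<Sum>k. fps_nth F k * w (t - int k)) = (\<Sum>k = 0..nat (t + int M). fps_nth F k * w (t - int k))"
  proof (rule suminf_finite)
    fix n assume "n \<notin> {0..nat (t + int M)}"
    then have "t - int n < - int M" by auto
    then show "fps_nth F n * w (t - int n) = 0" using assms by simp
  qed simp
  then show ?thesis using False by (simp add: shift_filter_def)
qed

lemma prediction_error_explicit:
  fixes b c :: "nat \<Rightarrow> real"
  assumes "\<And>s. s < - int M \<Longrightarrow> y s = 0 \<and> u s = 0" and "t \<ge> - int M"
  defines "h \<equiv> fps_nth (inverse (C_series c))"
  shows "prediction_error u y (b, c) t =
    (\<Sum>k = 0..nat (t + int M). h k * y (t - int k)) -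
    (\<Sum>k = 0..nat (t + int M). \<Sum>l = 1..nat (t - int k + int M).
       h k * b l * u (t - int k - int l))"
proof -
  let ?w = "\<lambda>t. y t - shift_filter (B_series b) u t"
  have sf: "shift_filter (B_series b) u s =
      (\<Sum>l = 1..nat (s + int M). b l * u (s - int l))" if "s \<ge> - int M" for s
  proof -
    have "shift_filter (B_series b) u s =
        (\<Sum>l = 0..nat (s + int M). fps_nth (B_series b) l * u (s - int l))"
      using shift_filter_finite[of M u] assms(1) that by simp
    also have "\<dots> = (\<Sum>l = 1..nat (s + int M). fps_nth (B_series b) l * u (s - int l))"
      by (simp add: sum.atLeast_Suc_atMost B_series_def)
    also have "\<dots> = (\<Sum>l = 1..nat (s + int M). b l * u (s - int l))"
      by (rule sum.cong) (auto simp: B_series_def)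
    finally show ?thesis .
  qed
  have "?w s = 0" if "s < - int M" for s
    using shift_filter_finite[of M u] assms(1) that by simp
  then have "prediction_error u y (b, c) t = (\<Sum>k = 0..nat (t + int M). h k * ?w (t - int k))"
    using shift_filter_finite[of M ?w] assms(2) by (simp add: prediction_error_def h_def)
  also have "\<dots> = (\<Sum>k = 0..nat (t + int M). h k * y (t - int k) -
      (\<Sum>l = 1..nat (t - int k + int M). h k * b l * u (t - int k - int l)))"
  proof (rule sum.cong)
    fix k assume "k \<in> {0..nat (t + int M)}"
    then have "t - int k \<ge> - int M" using assms(2) by auto
    then show "h k * ?w (t - int k) = h k * y (t - int k) -
      (\<Sum>l = 1..nat (t - int k + int M). h k * b l * u (t - int k - int l))"
      by (simp add: sf right_diff_distrib sum_distrib_left mult.assoc)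
  qed simp
  finally show ?thesis by (simp add: sum_subtractf)
qed

end

theory Submission
  imports Defs
begin

text \<open>
  On the time window from \<open>1\<close> to \<open>N\<close> the prediction errors involve the sequences \<open>b\<close> and \<open>c\<close> only
  through their entries with index at most \<open>N + M\<close>: the signals vanish before \<open>- M\<close>, and the first
  coefficients of \<open>1 / C(z)\<close> depend only on the first coefficients of \<open>C(z)\<close>
  (\<open>avg_sq_error_cong\<close>).  Hence, if \<open>b\<close> is replaced by another element of its space with the same
  first \<open>N + M\<close> entries, only the penalty on \<open>b\<close> changes.  So the \<open>b\<close>-part of a minimiser has
  minimal norm among all elements that share these entries with it, and likewise the \<open>c\<close>-part.

  In a reproducing kernel Hilbert space, every element agrees on a finite set \<open>S\<close> with some
  combination of the kernel columns indexed by \<open>S\<close> (\<open>interpolation\<close>).  The difference \<open>r\<close> of the two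
  vanishes on \<open>S\<close>, so it is orthogonal to those columns, and by Pythagoras the combination has norm
  strictly smaller than the given element unless \<open>r = 0\<close>.  An element of minimal norm is therefore
  itself such a combination (\<open>minimal_norm_representation\<close>).
\<close>

context function_hilbert_space
begin

lemma diff_mem: "f \<in> H \<Longrightarrow> g \<in> H \<Longrightarrow> (\<lambda>x. f x - g x) \<in> H"
  using add_mem[of f "\<lambda>x. (-1) * g x"] scale_mem[of g "-1"] by simp

lemma sum_mem:
  assumes "\<And>j. j \<in> S \<Longrightarrow> g j \<in> H"
  shows "(\<lambda>x. \<Sum>j\<in>S. a j * g j x) \<in> H"
  using assms
proof (induction S rule: infinite_finite_induct)
  case (insert j S)
  then show ?case
    using add_mem[of "\<lambda>x. a j * g j x" "\<lambda>x. \<Sum>j\<in>S. a j * g j x"] scale_mem[of "g j" "a j"]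
    by simp
qed (simp_all add: zero_mem)

lemma ip_zero_left: "h \<in> H \<Longrightarrow> ip (\<lambda>x. 0) h = 0"
  using ip_scale[of h h 0] by simp

lemma ip_sum_left:
  assumes "\<And>j. j \<in> S \<Longrightarrow> g j \<in> H" and "h \<in> H"
  shows "ip (\<lambda>x. \<Sum>j\<in>S. a j * g j x) h = (\<Sum>j\<in>S. a j * ip (g j) h)"
  using assms
proof (induction S rule: infinite_finite_induct)
  case (insert j S)
  then have "ip (\<lambda>x. a j * g j x + (\<Sum>j\<in>S. a j * g j x)) h
      = ip (\<lambda>x. a j * g j x) h + ip (\<lambda>x. \<Sum>j\<in>S. a j * g j x) h"
    by (intro ip_add scale_mem sum_mem) auto
  with insert show ?case
    by (simp add: ip_scale)
qed (simp_all add: ip_zero_left)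

lemma ip_add_orthogonal:
  assumes "f \<in> H" "g \<in> H" "ip f g = 0"
  shows "ip (\<lambda>x. f x + g x) (\<lambda>x. f x + g x) = ip f f + ip g g"
  using assms by (simp add: ip_add add_mem ip_commute[of _ "\<lambda>x. f x + g x"] ip_commute[of g f])

lemma ip_norm_power2: "f \<in> H \<Longrightarrow> (ip_norm ip f)\<^sup>2 = ip f f"
  by (simp add: ip_norm_def ip_nonneg)

end

context rkhs
begin

lemma columns_mem: "S \<subseteq> X \<Longrightarrow> (\<lambda>x. \<Sum>j\<in>S. a j * kernel_column X K j x) \<in> H"
  by (intro sum_mem column_mem) auto

lemma ip_columns:
  assumes "S \<subseteq> X" "f \<in> H"
  shows "ip (\<lambda>x. \<Sum>j\<in>S. a j * kernel_column X K j x) f = (\<Sum>j\<in>S. a j * f j)"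
proof -
  have "ip (\<lambda>x. \<Sum>j\<in>S. a j * kernel_column X K j x) f
      = (\<Sum>j\<in>S. a j * ip (kernel_column X K j) f)"
    using assms by (intro ip_sum_left column_mem) auto
  also have "\<dots> = (\<Sum>j\<in>S. a j * f j)"
    using assms by (intro sum.cong) (auto simp: ip_commute[of _ f] column_mem reproducing)
  finally show ?thesis .
qed

text \<open>
  This is the orthogonal projection onto the span of the columns indexed by \<open>S\<close>, built by a
  Gram--Schmidt step for each new point; no invertibility of the Gram matrix is needed.
\<close>

lemma interpolation:
  assumes "finite S" "S \<subseteq> X" "f \<in> H"
  shows "\<exists>a. \<forall>k\<in>S. f k = (\<Sum>j\<in>S. a j * kernel_column X K j k)"
  using assms
proof (induction S arbitrary: f rule: finite_induct)
  case empty
  then show ?case by simp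
next
  case (insert m S)
  let ?col = "kernel_column X K"
  have S: "S \<subseteq> X" and m: "m \<in> X"
    using insert.prems by auto
  obtain a where a: "\<forall>k\<in>S. f k = (\<Sum>j\<in>S. a j * ?col j k)"
    using insert.IH[OF S \<open>f \<in> H\<close>] by blast
  obtain d where d: "\<forall>k\<in>S. ?col m k = (\<Sum>j\<in>S. d j * ?col j k)"
    using insert.IH[OF S column_mem[OF m]] by blast
  define r where "r = (\<lambda>x. f x - (\<Sum>j\<in>S. a j * ?col j x))"
  define e where "e = (\<lambda>x. ?col m x - (\<Sum>j\<in>S. d j * ?col j x))"
  have rH: "r \<in> H" and eH: "e \<in> H"
    unfolding r_def e_def
    by (intro diff_mem columns_mem column_mem S m insert.prems(2))+
  have r0: "r k = 0" and e0: "e k = 0" if "k \<in> S" for k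
    using a d that by (simp_all add: r_def e_def)
  \<comment> \<open>Elements that vanish on \<open>S\<close> do not distinguish \<open>e\<close> from the column at \<open>m\<close>.\<close>
  have ip_e: "ip g e = g m" if "g \<in> H" "\<And>k. k \<in> S \<Longrightarrow> g k = 0" for g
  proof -
    have "g m = ip (?col m) g"
      using that m by (simp add: reproducing ip_commute[of _ g] column_mem)
    also have "?col m = (\<lambda>x. e x + (\<Sum>j\<in>S. d j * ?col j x))"
      by (simp add: e_def)
    also have "ip \<dots> g = ip e g + (\<Sum>j\<in>S. d j * g j)"
      using that S eH by (subst ip_add) (auto intro: columns_mem simp: ip_columns)
    also have "\<dots> = ip g e"
      using that eH by (simp add: ip_commute)
    finally show ?thesis by simp
  qed
  define s where "s = r m / e m"
  have rm: "r m = s * e m"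
  proof (cases "e m = 0")
    case True
    then have "e = (\<lambda>x. 0)"
      using ip_e[OF eH e0] ip_eq_0[OF eH] by simp
    \<comment> \<open>The new column already lies in the span of the old ones, so \<open>r\<close> vanishes at \<open>m\<close> too.\<close>
    then have "r m = 0"
      using ip_e[OF rH r0] ip_zero_left[OF rH] ip_commute[OF rH eH] by simp
    with True show ?thesis by simp
  qed (simp add: s_def)
  define a' where "a' = (\<lambda>j. if j = m then s else a j - s * d j)"
  have "f k = (\<Sum>j\<in>insert m S. a' j * ?col j k)" if "k \<in> insert m S" for k
  proof -
    have "r k = s * e k"
      using that r0 e0 rm by auto
    moreover have "(\<Sum>j\<in>S. a' j * ?col j k)
        = (\<Sum>j\<in>S. a j * ?col j k) - s * (\<Sum>j\<in>S. d j * ?col j k)"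
      using insert.hyps(2)
      by (auto simp: a'_def sum_distrib_left left_diff_distrib mult.assoc
          simp flip: sum_subtractf intro!: sum.cong)
    moreover have "(\<Sum>j\<in>insert m S. a' j * ?col j k) = s * ?col m k + (\<Sum>j\<in>S. a' j * ?col j k)"
      using insert.hyps by (simp add: a'_def)
    ultimately show ?thesis
      by (simp add: r_def e_def algebra_simps)
  qed
  then show ?case by blast
qed

lemma minimal_norm_representation:
  assumes "finite S" "S \<subseteq> X" "f \<in> H"
    and minimal: "\<And>g. g \<in> H \<Longrightarrow> (\<And>k. k \<in> S \<Longrightarrow> g k = f k) \<Longrightarrow> ip f f \<le> ip g g"
  shows "\<exists>a. f = (\<lambda>x. \<Sum>j\<in>S. a j * kernel_column X K j x)"
proof -
  obtain a where a: "\<forall>k\<in>S. f k = (\<Sum>j\<in>S. a j * kernel_column X K j k)"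
    using interpolation[OF assms(1-3)] by blast
  define p where "p = (\<lambda>x. \<Sum>j\<in>S. a j * kernel_column X K j x)"
  define r where "r = (\<lambda>x. f x - p x)"
  have pH: "p \<in> H"
    unfolding p_def by (rule columns_mem[OF assms(2)])
  have rH: "r \<in> H"
    unfolding r_def by (rule diff_mem[OF assms(3) pH])
  have "r k = 0" if "k \<in> S" for k
    using a that by (simp add: r_def p_def)
  then have "ip p r = 0"
    using ip_columns[OF assms(2) rH, of a] by (simp add: p_def)
  then have "ip f f = ip p p + ip r r"
    using ip_add_orthogonal[OF pH rH] by (simp add: r_def)
  moreover have "ip f f \<le> ip p p"
    using a by (intro minimal pH) (simp add: p_def)
  ultimately have "ip r r = 0"
    using ip_nonneg[OF rH] by simp
  then have "r = (\<lambda>x. 0)"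
    by (rule ip_eq_0[OF rH])
  then have "f = p"
    by (simp add: r_def fun_eq_iff)
  then show ?thesis
    unfolding p_def by blast
qed

end

lemma inverse_C_series_cong:
  assumes "\<And>i. i \<in> {1..n} \<Longrightarrow> c i = c' i" and "k \<le> n"
  shows "fps_nth (inverse (C_series c)) k = fps_nth (inverse (C_series c')) k"
  using assms(2)
proof (induction k rule: less_induct)
  case (less k)
  show ?case
  proof (cases "k = 0")
    case True
    then show ?thesis by (simp only: inverse_C_series_0)
  next
    case False
    have "(\<Sum>i = 1..k - 1. c i * fps_nth (inverse (C_series c)) (k - i))
        = (\<Sum>i = 1..k - 1. c' i * fps_nth (inverse (C_series c')) (k - i))"
      using less assms(1) by (intro sum.cong refl arg_cong2[where f = "(*)"]) auto
    then show ?thesis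
      using False less.prems assms(1) by (simp add: inverse_C_series_rec)
  qed
qed

lemma prediction_error_cong:
  assumes past: "\<And>s. s < - int M \<Longrightarrow> y s = 0 \<and> u s = 0"
    and t: "1 \<le> t" "t \<le> N"
    and b: "\<And>k. k \<in> {1..N + M} \<Longrightarrow> b k = b' k"
    and c: "\<And>k. k \<in> {1..N + M} \<Longrightarrow> c k = c' k"
  shows "prediction_error u y (b, c) (int t) = prediction_error u y (b', c') (int t)"
proof -
  have h: "fps_nth (inverse (C_series c)) k = fps_nth (inverse (C_series c')) k"
    if "k \<le> nat (int t + int M)" for k
    using that t by (intro inverse_C_series_cong[of "N + M"] c) auto
  have bl: "b l = b' l" if "1 \<le> l" "l \<le> nat (int t - int k + int M)" for k l
    using that t by (intro b) auto
  have expl: "prediction_error u y (b, c) (int t) =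
    (\<Sum>k = 0..nat (int t + int M). fps_nth (inverse (C_series c)) k * y (int t - int k)) -
    (\<Sum>k = 0..nat (int t + int M). \<Sum>l = 1..nat (int t - int k + int M).
       fps_nth (inverse (C_series c)) k * b l * u (int t - int k - int l))" for b c
    using past by (intro prediction_error_explicit) auto
  show ?thesis
    unfolding expl
    by (intro arg_cong2[where f = "(-)"] sum.cong refl) (auto simp: h bl)
qed

lemma avg_sq_error_cong:
  assumes "\<And>s. s < - int M \<Longrightarrow> y s = 0 \<and> u s = 0"
    and "\<And>k. k \<in> {1..N + M} \<Longrightarrow> b k = b' k"
    and "\<And>k. k \<in> {1..N + M} \<Longrightarrow> c k = c' k"
  shows "avg_sq_error N u y (b, c) = avg_sq_error N u y (b', c')"
proof -
  have "prediction_error u y (b, c) (int t) = prediction_error u y (b', c') (int t)"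
    if "t \<in> {1..N}" for t
    using that by (intro prediction_error_cong[of M _ _ _ N] assms) auto
  then show ?thesis
    by (simp add: avg_sq_error_def)
qed

theorem corollary11:
  fixes N M :: nat
    and u y :: "int \<Rightarrow> real"
    and \<sigma> lam_b lam_c \<gamma>_b \<gamma>_c :: real
    and Hb Hc :: "(nat \<Rightarrow> real) set"
    and ip_b ip_c :: "(nat \<Rightarrow> real) \<Rightarrow> (nat \<Rightarrow> real) \<Rightarrow> real"
    and Kb Kc :: "nat \<Rightarrow> nat \<Rightarrow> real"
    and b c :: "nat \<Rightarrow> real"
  assumes N: "N \<ge> 1"
    and pos: "\<sigma>\<^sup>2 > 0" "lam_b > 0" "lam_c > 0"
    and gamma_b: "\<gamma>_b = \<sigma>\<^sup>2 / (real N * lam_b)"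
    and gamma_c: "\<gamma>_c = \<sigma>\<^sup>2 / (real N * lam_c)"
    and rkhs_b: "rkhs {1..} Hb ip_b Kb" and sub_b: "Hb \<subseteq> ell2"
    and rkhs_c: "rkhs {1..} Hc ip_c Kc" and sub_c: "Hc \<subseteq> ell2"
    and stable_b: "Hb \<subseteq> ell1"
    and stable_c: "Hc \<subseteq> ell1"
    and past: "\<And>s. s < - int M \<Longrightarrow> y s = 0 \<and> u s = 0"
    and solution: "is_arg_min
      (\<lambda>(b, c). avg_sq_error N u y (b, c) + \<gamma>_b * (ip_norm ip_b b)\<^sup>2 + \<gamma>_c * (ip_norm ip_c c)\<^sup>2)
      (\<lambda>\<theta>. \<theta> \<in> Hb \<times> Hc) (b, c)"
  shows "\<exists>\<alpha> \<beta> :: nat \<Rightarrow> real.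
    b = (\<lambda>i. \<Sum>k = 1..N + M. \<alpha> k * kernel_column {1..} Kb k i) \<and>
    c = (\<lambda>i. \<Sum>k = 1..N + M. \<beta> k * kernel_column {1..} Kc k i)"
proof -
  interpret b: rkhs "{1..}" Hb ip_b Kb by (rule rkhs_b)
  interpret c: rkhs "{1..}" Hc ip_c Kc by (rule rkhs_c)
  have \<gamma>: "\<gamma>_b > 0" "\<gamma>_c > 0"
    using N pos unfolding gamma_b gamma_c by (auto intro!: divide_pos_pos mult_pos_pos)
  have bH: "b \<in> Hb" and cH: "c \<in> Hc"
    using solution by (auto simp: is_arg_min_def)
  have min: "avg_sq_error N u y (b, c) + \<gamma>_b * ip_b b b + \<gamma>_c * ip_c c c
      \<le> avg_sq_error N u y (b', c') + \<gamma>_b * ip_b b' b' + \<gamma>_c * ip_c c' c'"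
    if "b' \<in> Hb" "c' \<in> Hc" for b' c'
    using solution that
    by (auto simp: is_arg_min_linorder b.ip_norm_power2 c.ip_norm_power2)
  have "ip_b b b \<le> ip_b g g"
    if "g \<in> Hb" and agree: "\<And>k. k \<in> {1..N + M} \<Longrightarrow> g k = b k" for g
  proof -
    have "avg_sq_error N u y (g, c) = avg_sq_error N u y (b, c)"
      using past agree by (intro avg_sq_error_cong[of M]) auto
    then show ?thesis
      using min[OF \<open>g \<in> Hb\<close> cH] \<gamma> by simp
  qed
  then have "\<exists>\<alpha>. b = (\<lambda>i. \<Sum>k = 1..N + M. \<alpha> k * kernel_column {1..} Kb k i)"
    by (intro b.minimal_norm_representation bH) auto
  moreover have "ip_c c c \<le> ip_c g g"
    if "g \<in> Hc" and agree: "\<And>k. k \<in> {1..N + M} \<Longrightarrow> g k = c k" for g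
  proof -
    have "avg_sq_error N u y (b, g) = avg_sq_error N u y (b, c)"
      using past agree by (intro avg_sq_error_cong[of M]) auto
    then show ?thesis
      using min[OF bH \<open>g \<in> Hc\<close>] \<gamma> by simp
  qed
  then have "\<exists>\<beta>. c = (\<lambda>i. \<Sum>k = 1..N + M. \<beta> k * kernel_column {1..} Kc k i)"
    by (intro c.minimal_norm_representation cH) auto
  ultimately show ?thesis by blast
qed

end
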